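(* A nonempty space $X$ is rectifiable if and only if there exists a homogeneous Mal'tsev operation on $X$.
   Context: A space means a regular topological space. A space $X$ is rectifiable if there exist a point $e\in X$ and a homeomorphism $\Psi:X^2\to X^2$ (a rectification) of the form $\Psi(x,y)=(x,p(x,y))$ for some map $p:X^2\to X$ with $p(x,x)=e$ for all $x\in X$. A homogeneous Mal'tsev operation on $X$ is a continuous map $P:X^3\to X$ such that $P(x,y,y)=P(y,y,x)=x$ and $P(x,y,P(y,x,u))=u$ for all $x,y,u\in X$. *)

theory Defs
  imports "HOL-Analysis.Analysis"
begin

text \<open>
  A space is an abstract topology, so every function is relativised to its carrier
  \<^term>\<open>topspace X\<close>; values outside the carrier are irrelevant.
\<close>

definition rectification ::
    "'a topology \<Rightarrow> 'a \<Rightarrow> ('a \<times> 'a \<Rightarrow> 'a \<times> 'a) \<Rightarrow> bool" where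
  "rectification X e \<Psi> \<longleftrightarrow>
     homeomorphic_map (prod_topology X X) (prod_topology X X) \<Psi> \<and>
     (\<exists>p \<in> topspace (prod_topology X X) \<rightarrow> topspace X.
        (\<forall>x \<in> topspace X. \<forall>y \<in> topspace X. \<Psi> (x, y) = (x, p (x, y))) \<and>
        (\<forall>x \<in> topspace X. p (x, x) = e))"

definition rectifiable_space :: "'a topology \<Rightarrow> bool" where
  "rectifiable_space X \<longleftrightarrow> (\<exists>e \<in> topspace X. \<exists>\<Psi>. rectification X e \<Psi>)"

definition homogeneous_Maltsev_operation ::
    "'a topology \<Rightarrow> ('a \<times> 'a \<times> 'a \<Rightarrow> 'a) \<Rightarrow> bool" where
  "homogeneous_Maltsev_operation X P \<longleftrightarrow>
     continuous_map (prod_topology X (prod_topology X X)) X P \<and>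
     (\<forall>x \<in> topspace X. \<forall>y \<in> topspace X. P (x, y, y) = x \<and> P (y, y, x) = x) \<and>
     (\<forall>x \<in> topspace X. \<forall>y \<in> topspace X. \<forall>u \<in> topspace X. P (x, y, P (y, x, u)) = u)"

end

theory Submission
  imports Defs
begin

text \<open>
  Writing the inverse of a rectification $(x,y) \mapsto (x,p(x,y))$ as $(x,z) \mapsto (x,q(x,z))$,
  the operation $P(x,y,u) = q(x,p(y,u))$ is homogeneous Mal'tsev.  Conversely, for any fixed $e$ the
  maps $p(x,y) = P(e,x,y)$ and $q(x,z) = P(x,e,z)$ are mutually inverse in the second variable.
\<close>

lemma rectification_imp_homogeneous_Maltsev_operation:
  assumes "rectification X e \<Psi>"
  obtains P where "homogeneous_Maltsev_operation X P"
proof -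
  obtain p where p: "\<And>x y. x \<in> topspace X \<Longrightarrow> y \<in> topspace X \<Longrightarrow> \<Psi> (x, y) = (x, p (x, y))"
    and pe: "\<And>x. x \<in> topspace X \<Longrightarrow> p (x, x) = e"
    and pX: "\<And>x y. x \<in> topspace X \<Longrightarrow> y \<in> topspace X \<Longrightarrow> p (x, y) \<in> topspace X"
    and hom: "homeomorphic_map (prod_topology X X) (prod_topology X X) \<Psi>"
    using assms unfolding rectification_def by (auto simp: Pi_iff)
  obtain \<Phi> where "homeomorphic_maps (prod_topology X X) (prod_topology X X) \<Psi> \<Phi>"
    using hom homeomorphic_map_maps by blast
  then have cont: "continuous_map (prod_topology X X) (prod_topology X X) \<Psi>"
      "continuous_map (prod_topology X X) (prod_topology X X) \<Phi>"
    and inv: "\<And>x y. x \<in> topspace X \<Longrightarrow> y \<in> topspace X \<Longrightarrow> \<Phi> (\<Psi> (x, y)) = (x, y)"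
      "\<And>x y. x \<in> topspace X \<Longrightarrow> y \<in> topspace X \<Longrightarrow> \<Psi> (\<Phi> (x, y)) = (x, y)"
    by (auto simp: homeomorphic_maps_def)
  define q where "q = snd \<circ> \<Phi>"
  have \<Phi>X: "\<Phi> (x, z) \<in> topspace X \<times> topspace X"
    if "x \<in> topspace X" "z \<in> topspace X" for x z
    using continuous_map_image_subset_topspace[OF cont(2)] that by auto
  have qX: "q (x, z) \<in> topspace X" if "x \<in> topspace X" "z \<in> topspace X" for x z
    using \<Phi>X[OF that] by (auto simp: q_def mem_Times_iff)
  have qp: "q (x, p (x, y)) = y" if "x \<in> topspace X" "y \<in> topspace X" for x y
    using inv(1)[OF that] p[OF that] by (simp add: q_def)
  \<comment> \<open>\<open>q\<close> keeps only the second coordinate of \<open>\<Phi>\<close>, so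
    the first must be recovered: writing \<open>\<Phi> (x, z) = (a, b)\<close>, the equation
    \<open>\<Psi> (a, b) = (x, z)\<close> forces \<open>a = x\<close> because \<open>\<Psi>\<close>
    preserves first coordinates.\<close>
  have pq: "p (x, q (x, z)) = z" if xz: "x \<in> topspace X" "z \<in> topspace X" for x z
  proof -
    obtain a b where ab: "\<Phi> (x, z) = (a, b)" "a \<in> topspace X" "b \<in> topspace X"
      using \<Phi>X[OF xz] by auto
    then show ?thesis
      using inv(2)[OF xz] p[OF ab(2,3)] by (auto simp: q_def)
  qed
  have qe: "q (x, e) = x" if "x \<in> topspace X" for x
    using qp[OF that that] pe[OF that] by simp
  have cq: "continuous_map (prod_topology X X) X q"
    unfolding q_def using cont(2) continuous_map_compose continuous_map_snd by blast
  have "continuous_map (prod_topology X X) X (snd \<circ> \<Psi>)"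
    using cont(1) continuous_map_compose continuous_map_snd by blast
  \<comment> \<open>\<open>p\<close> agrees with \<open>snd \<circ> \<Psi>\<close> on the carrier
    only, so continuity is transferred along that agreement.\<close>
  then have cp: "continuous_map (prod_topology X X) X p"
    by (rule continuous_map_eq) (auto simp: p)
  have "continuous_map (prod_topology X (prod_topology X X)) X (q \<circ> (\<lambda>t. (fst t, (p \<circ> snd) t)))"
    by (intro continuous_map_compose[OF _ cq] continuous_map_pairedI continuous_map_fst
        continuous_map_compose[OF continuous_map_snd cp])
  \<comment> \<open>With \<open>t = (x, y, u)\<close> this is q(x, p(y,u)). The identities are q(x,
    p(y,y)) = q(x,e) = x, q(y, p(y,x)) = x, and q(x, p(y, q(y, p(x,u)))) = q(x, p(x,u)) = u, where
    \<open>pq\<close> cancels the inner pair.\<close>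
  then have "homogeneous_Maltsev_operation X (q \<circ> (\<lambda>t. (fst t, (p \<circ> snd) t)))"
    unfolding homogeneous_Maltsev_operation_def by (simp add: pe qe qp pq pX qX)
  then show thesis by (rule that)
qed

text \<open>Any point can serve as base point: the law \<open>P (x, y, y) = x\<close> with first
  argument \<open>e\<close> gives \<open>P (e, x, x) = e\<close>, the condition on the
  diagonal.\<close>

lemma homogeneous_Maltsev_operation_imp_rectification:
  assumes "homogeneous_Maltsev_operation X P" and e: "e \<in> topspace X"
  shows "rectification X e (\<lambda>t. (fst t, P (e, t)))"
proof -
  have cont: "continuous_map (prod_topology X (prod_topology X X)) X P"
    and Pe: "\<And>x y. x \<in> topspace X \<Longrightarrow> y \<in> topspace X \<Longrightarrow> P (x, y, y) = x"
    and PP: "\<And>x y u. x \<in> topspace X \<Longrightarrow> y \<in> topspace X \<Longrightarrow> u \<in> topspace X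
               \<Longrightarrow> P (x, y, P (y, x, u)) = u"
    using assms(1) by (auto simp: homogeneous_Maltsev_operation_def)
  have PX: "P (x, y, u) \<in> topspace X"
    if "x \<in> topspace X" "y \<in> topspace X" "u \<in> topspace X" for x y u
    using continuous_map_image_subset_topspace[OF cont] that by auto
  have "continuous_map (prod_topology X X) X (P \<circ> (\<lambda>t. (e, t)))"
    by (intro continuous_map_compose[OF _ cont] continuous_map_pairedI)
      (use e in \<open>auto simp: continuous_map_id[unfolded id_def]\<close>)
  then have c1: "continuous_map (prod_topology X X) X (\<lambda>t. P (e, t))"
    by (simp add: o_def)
  have "continuous_map (prod_topology X X) X (P \<circ> (\<lambda>t. (fst t, e, snd t)))"
    by (intro continuous_map_compose[OF _ cont] continuous_map_pairedI
        continuous_map_fst continuous_map_snd) (use e in auto)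
  then have c2: "continuous_map (prod_topology X X) X (\<lambda>t. P (fst t, e, snd t))"
    by (simp add: o_def)
  \<comment> \<open>Both inverse laws are instances of \<open>PP\<close>: P(x, e, P(e,x,y)) = y for
    one composite, and P(e, x, P(x,e,z)) = z, with the roles of \<open>x\<close> and
    \<open>e\<close> exchanged, for the other.\<close>
  have "homeomorphic_maps (prod_topology X X) (prod_topology X X)
          (\<lambda>t. (fst t, P (e, t))) (\<lambda>t. (fst t, P (fst t, e, snd t)))"
    unfolding homeomorphic_maps_def
    by (intro conjI continuous_map_pairedI continuous_map_fst c1 c2) (auto simp: PP e)
  then have "homeomorphic_map (prod_topology X X) (prod_topology X X) (\<lambda>t. (fst t, P (e, t)))"
    using homeomorphic_map_maps by blast
  then show ?thesis
    unfolding rectification_def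
    by (intro conjI bexI[of _ "\<lambda>t. P (e, t)"]) (auto simp: PX Pe e)
qed

theorem proposition1:
  fixes X :: "'a topology"
  assumes "regular_space X"
    and "topspace X \<noteq> {}"
  shows "rectifiable_space X \<longleftrightarrow> (\<exists>P. homogeneous_Maltsev_operation X P)"
  \<comment> \<open>Nonemptiness supplies the base point \<open>e\<close> when passing from
    \<open>P\<close> to a rectification.\<close>
  using assms(2) unfolding rectifiable_space_def
  by (meson rectification_imp_homogeneous_Maltsev_operation
      homogeneous_Maltsev_operation_imp_rectification ex_in_conv)

end
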